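(* Let $n\ge 1$ and let $f:\mathbb{H}^n\to\mathbb{H}$ be a holomorphic mapping such that for some constant $c>0$ $$f(z_1+c,\dots,z_n+c)=f(z_1,\dots,z_n)+c\quad\text{for all } z_1,\dots,z_n\in\mathbb{H}.$$ Assume that there exist a sequence $(t_j)_{j\ge1}$ of positive real numbers with $t_j\to\infty$ and a holomorphic mapping $h:\mathbb{H}^n\to\mathbb{H}$ such that $\frac{1}{t_j}f(t_jz)\to h(z)$ as $j\to\infty$ for every $z\in\mathbb{H}^n$. Then $h$ is linear. Moreover, if there exists a point $w\in\mathbb{H}^n$ such that $\operatorname{Im}(f(w)-h(w))=0$, then there is a constant $\alpha\in\mathbb{R}$ such that $f(z)=h(z)+\alpha$ for all $z\in\mathbb{H}^n$.
   Context: $\mathbb{H}=\{\lambda\in\mathbb{C}:\operatorname{Im}\lambda>0\}$ is the open upper half-plane and $\mathbb{H}^n$ is its $n$-fold Cartesian product in $\mathbb{C}^n$. For $t>0$ and $z=(z_1,\dots,z_n)\in\mathbb{H}^n$, $tz=(tz_1,\dots,tz_n)$. "$h$ is linear" means that there are constants $a_1,\dots,a_n\in\mathbb{C}$ with $h(z)=\sum_{k=1}^n a_kz_k$ for all $z\in\mathbb{H}^n$. *)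

theory Defs
  imports "HOL-Analysis.Analysis"
begin

definition upper_half_plane :: "complex set" where
  "upper_half_plane = {z. Im z > 0}"

definition upper_half_space :: "(complex ^ 'n) set" where
  "upper_half_space = {z. \<forall>k. z $ k \<in> upper_half_plane}"

text \<open>Holomorphy in several variables: at every point of the (open) set the function has a
  Frechet derivative that is complex linear. The library's derivative is only real linear, so
  complex homogeneity is required separately.\<close>

definition holomorphic_several :: "(complex ^ 'n \<Rightarrow> complex) \<Rightarrow> (complex ^ 'n) set \<Rightarrow> bool" where
  "holomorphic_several f S \<longleftrightarrow>
     (\<forall>z\<in>S. \<exists>D. (f has_derivative D) (at z within S) \<and> (\<forall>a v. D (a *s v) = a * D v))"

definition linear_on_upper_half_space :: "(complex ^ 'n \<Rightarrow> complex) \<Rightarrow> bool" where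
  "linear_on_upper_half_space h \<longleftrightarrow>
     (\<exists>a :: complex ^ 'n. \<forall>z\<in>upper_half_space. h z = (\<Sum>k\<in>UNIV. a $ k * z $ k))"

end

theory Submission
  imports Defs "HOL-Complex_Analysis.Conformal_Mappings"
begin

text \<open>For real \<open>x\<close> and positive \<open>y\<close>, Julia's inequality for the self-map \<open>\<lambda> \<mapsto> f (x + \<lambda> y)\<close> of the
  half-plane shows that \<open>h (i y)\<close> is purely imaginary and
  \<open>Im f (x + \<lambda> y) \<ge> Im h (i y) \<cdot> Im \<lambda>\<close>. Applying this along \<open>\<lambda> = i s t\<^sub>j\<close> gives
  \<open>Im h (i s y) \<ge> s Im h (i y)\<close>, so by symmetry \<open>h\<close> is homogeneous on the purely imaginary points.
  The rescaled maps are equicontinuous (Schwarz--Pick) and commute with shifts by \<open>c / t\<^sub>j \<rightarrow> 0\<close>, so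
  \<open>h (z + s \<cdot> 1) = h z + s\<close> for real \<open>s\<close>, hence for \<open>s = i\<close>. Both facts together identify \<open>h\<close> on the
  purely imaginary points, and so everywhere, with its derivative at \<open>i \<cdot> 1\<close>. Finally
  \<open>Im (f - h) \<ge> 0\<close>, and equality at one point forces \<open>f - h\<close> to be constant by the open mapping
  theorem on complex lines.\<close>

section \<open>The half-space and its complex lines\<close>

lemma in_upper_half_space_iff: "z \<in> upper_half_space \<longleftrightarrow> (\<forall>k. Im (z $ k) > 0)"
  by (simp add: upper_half_space_def upper_half_plane_def)

lemma open_upper_half_space: "open (upper_half_space :: (complex ^ 'n) set)"
proof -
  have "open ((\<lambda>z :: complex ^ 'n. z $ k) -` {w. Im w > 0})" for k
    by (intro open_vimage open_halfspace_Im_gt continuous_intros)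
  hence "open (\<Inter>k. (\<lambda>z :: complex ^ 'n. z $ k) -` {w. Im w > 0})"
    by (intro open_INT) auto
  also have "(\<Inter>k. (\<lambda>z :: complex ^ 'n. z $ k) -` {w. Im w > 0}) = upper_half_space"
    by (auto simp: upper_half_space_def upper_half_plane_def)
  finally show ?thesis .
qed

lemma bounded_linear_vector_scale: "bounded_linear (\<lambda>l :: complex. l *s (v :: complex ^ 'n))"
proof -
  have "linear (\<lambda>l :: complex. l *s v)"
    by (rule linearI) (auto simp: vec_eq_iff algebra_simps)
  thus ?thesis by (simp add: linear_linear)
qed

lemma open_line_preimage:
  "open {l :: complex. p + l *s v \<in> (upper_half_space :: (complex ^ 'n) set)}"
proof -
  have "continuous_on UNIV (\<lambda>l. p + l *s v)"
    by (intro continuous_intros linear_continuous_on bounded_linear_vector_scale)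
  from open_vimage[OF open_upper_half_space this] show ?thesis
    by (simp add: vimage_def)
qed

text \<open>Each coordinate condition asks a real-affine function of \<open>l\<close> to be
  positive, and convexity passes to intersections. Convexity supplies the connectedness that the
  identity and open mapping theorems ask for.\<close>

lemma convex_line_preimage:
  "convex {l :: complex. p + l *s v \<in> (upper_half_space :: (complex ^ 'n) set)}"
proof -
  have "convex {l :: complex. Im (p $ k + l * v $ k) > 0}" for k
  proof (rule convexI, clarsimp)
    fix x y :: complex and u w :: real
    assume a: "0 < Im (p $ k) + (Re x * Im (v $ k) + Im x * Re (v $ k))"
      "0 < Im (p $ k) + (Re y * Im (v $ k) + Im y * Re (v $ k))" "0 \<le> u" "0 \<le> w" "u + w = 1"
    let ?X = "Im (p $ k) + (Re x * Im (v $ k) + Im x * Re (v $ k))"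
    let ?Y = "Im (p $ k) + (Re y * Im (v $ k) + Im y * Re (v $ k))"
    have "u * ?X + w * ?Y > 0"
      using convex_bound_lt[of "- ?X" 0 "- ?Y" u w] a by (simp add: algebra_simps)
    moreover have "u * ?X + w * ?Y = (u + w) * Im (p $ k) +
        ((u * Re x + w * Re y) * Im (v $ k) + (u * Im x + w * Im y) * Re (v $ k))"
      by (simp add: algebra_simps)
    ultimately show "0 < Im (p $ k) +
        ((u * Re x + w * Re y) * Im (v $ k) + (u * Im x + w * Im y) * Re (v $ k))"
      using a by simp
  qed
  hence "convex (\<Inter>k. {l :: complex. Im (p $ k + l * v $ k) > 0})"
    by (intro convex_INT) auto
  also have "(\<Inter>k. {l :: complex. Im (p $ k + l * v $ k) > 0}) = {l. p + l *s v \<in> upper_half_space}"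
    by (auto simp: upper_half_space_def upper_half_plane_def)
  finally show ?thesis .
qed

text \<open>By the chain rule and complex homogeneity of \<open>D\<close>, the derivative in
  \<open>l\<close> is multiplication by \<open>D v\<close>. One-variable theorems reach functions of
  several variables through such restrictions.\<close>

lemma holomorphic_several_on_line:
  assumes "holomorphic_several F S"
  shows "(\<lambda>l. F (p + l *s v)) holomorphic_on {l. p + l *s v \<in> S}"
  unfolding holomorphic_on_def
proof
  fix l assume l: "l \<in> {l. p + l *s v \<in> S}"
  then obtain D where D: "(F has_derivative D) (at (p + l *s v) within S)"
      and s: "\<And>a v. D (a *s v) = a * D v"
    using assms unfolding holomorphic_several_def by blast
  have line: "((\<lambda>l. p + l *s v) has_derivative (\<lambda>l. l *s v)) (at l within {l. p + l *s v \<in> S})"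
    using has_derivative_add[OF has_derivative_const
        bounded_linear_imp_has_derivative[OF bounded_linear_vector_scale]] by auto
  have "((\<lambda>l. F (p + l *s v)) has_derivative (\<lambda>l. D (l *s v))) (at l within {l. p + l *s v \<in> S})"
    by (rule has_derivative_in_compose[OF line has_derivative_subset[OF D]]) auto
  moreover have "(\<lambda>l. D (l *s v)) = (*) (D v)"
    by (auto simp: s)
  ultimately show "(\<lambda>l. F (p + l *s v)) field_differentiable at l within {l. p + l *s v \<in> S}"
    unfolding field_differentiable_def has_field_derivative_def by auto
qed

section \<open>Schwarz-Pick and Julia inequalities\<close>

lemma norm_diff_cnj_sq:
  "norm (a - cnj b) ^ 2 = norm (a - b) ^ 2 + 4 * Im a * Im b"
  unfolding cmod_power2 by (simp add: power2_eq_square algebra_simps)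

text \<open>The Cayley transform centred at \<open>G 0\<close> carries the half-plane to the unit
  disc and \<open>G 0\<close> to 0, so the Schwarz lemma applies to the composition
  \<open>C\<close>.\<close>

lemma Schwarz_Pick_disc:
  assumes hol: "G holomorphic_on ball 0 1"
    and pos: "\<And>z. norm z < 1 \<Longrightarrow> Im (G z) > 0"
    and z: "norm z < 1"
  shows "norm (G z - G 0) \<le> norm z * norm (G z - cnj (G 0))"
proof -
  have ne: "norm (G x - cnj (G 0)) > norm (G x - G 0)" if "norm x < 1" for x
  proof -
    have "norm (G x - cnj (G 0)) ^ 2 > norm (G x - G 0) ^ 2"
      using norm_diff_cnj_sq[of "G x" "G 0"] pos[OF that] pos[of 0] by simp
    thus ?thesis by (rule power2_less_imp_less) simp
  qed
  define C where "C x = (G x - G 0) / (G x - cnj (G 0))" for x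
  have "C holomorphic_on ball 0 1"
    unfolding C_def by (intro holomorphic_intros hol) (use ne in force)
  moreover have "C 0 = 0" by (simp add: C_def)
  moreover have "norm (C x) < 1" if "norm x < 1" for x
    using ne[OF that] unfolding C_def norm_divide
    by (subst divide_less_eq_1_pos) (auto intro: le_less_trans[OF norm_ge_zero])
  ultimately have "norm (C z) \<le> norm z"
    using z by (rule Schwarz_Lemma(1))
  thus ?thesis
    using ne[OF z] le_less_trans[OF norm_ge_zero ne[OF z]]
    by (simp add: C_def norm_divide pos_divide_le_eq)
qed

lemma Schwarz_Pick_half_plane:
  assumes hol: "g holomorphic_on {z. Im z > 0}"
    and pos: "\<And>z. Im z > 0 \<Longrightarrow> Im (g z) > 0"
    and z: "Im z > 0" and w: "Im w > 0"
  shows "norm (g z - g w) ^ 2 * (Im z * Im w) \<le> norm (z - w) ^ 2 * (Im (g z) * Im (g w))"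
proof -
  \<comment> \<open>The inverse of the Cayley transform centred at \<open>w\<close>: it maps the
    disc into the half-plane and 0 to \<open>w\<close>.\<close>
  define \<phi> where "\<phi> x = (w - cnj w * x) / (1 - x)" for x
  have pos\<phi>: "Im (\<phi> x) > 0" if "norm x < 1" for x
  proof -
    have "norm x ^ 2 < 1" using that by (simp add: power_less_one_iff)
    hence "Re x ^ 2 + Im x ^ 2 < 1" by (simp add: cmod_power2)
    \<comment> \<open>The left side equals \<open>Im w * (1 - norm x ^ 2)\<close>, because
      \<open>w * cnj x + cnj w * x\<close> is real.\<close>
    hence "Im ((w - cnj w * x) * cnj (1 - x)) > 0"
      using w mult_pos_pos[OF w, of "1 - Re x ^ 2 - Im x ^ 2"]
      by (simp add: algebra_simps power2_eq_square)
    moreover have "norm (1 - x) ^ 2 > 0" using that by auto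
    ultimately show ?thesis
      unfolding \<phi>_def by (subst complex_div_cnj) (simp add: Im_divide_of_real)
  qed
  have hol\<phi>: "(g \<circ> \<phi>) holomorphic_on ball 0 1"
  proof (rule holomorphic_on_compose_gen[OF _ hol])
    show "\<phi> holomorphic_on ball 0 1"
      unfolding \<phi>_def by (intro holomorphic_intros) auto
  qed (use pos\<phi> in auto)
  define x where "x = (z - w) / (z - cnj w)"
  have lt: "norm (z - cnj w) > norm (z - w)"
    by (rule power2_less_imp_less) (use norm_diff_cnj_sq[of z w] z w in auto)
  hence ne: "z - cnj w \<noteq> 0" by auto
  have nx: "norm x < 1"
    using lt ne by (simp add: x_def norm_divide)
  have "w - cnj w \<noteq> 0" using w by (auto simp: complex_eq_iff)
  moreover have "1 - x = (w - cnj w) / (z - cnj w)" "w - cnj w * x = z * (w - cnj w) / (z - cnj w)"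
    using ne by (auto simp: x_def field_simps)
  ultimately have "\<phi> x = z" using ne by (simp add: \<phi>_def)
  moreover have "\<phi> 0 = w" by (simp add: \<phi>_def)
  ultimately have "norm (g z - g w) \<le> norm x * norm (g z - cnj (g w))"
    using Schwarz_Pick_disc[OF hol\<phi> _ nx] pos pos\<phi> by auto
  hence "norm (g z - g w) * norm (z - cnj w) \<le> norm (z - w) * norm (g z - cnj (g w))"
    using ne by (simp add: x_def norm_divide field_simps)
  hence "(norm (g z - g w) * norm (z - cnj w)) ^ 2 \<le> (norm (z - w) * norm (g z - cnj (g w))) ^ 2"
    by (intro power_mono) auto
  \<comment> \<open>After expansion, the product of the squared distances
    \<open>norm (g z - g w) ^ 2\<close> and \<open>norm (z - w) ^ 2\<close> occurs on both sides and
    cancels.\<close>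
  thus ?thesis
    unfolding power_mult_distrib norm_diff_cnj_sq by (simp add: algebra_simps)
qed

text \<open>Schwarz-Pick between \<open>z\<close> and the points
  \<open>\<i> * of_real (T j)\<close>, rescaled by powers of \<open>T j\<close>, has a limit in
  which \<open>z\<close> survives only through \<open>Im z\<close> and \<open>Im (g z)\<close>. This
  limit is \<open>bound\<close>.\<close>

lemma Julia_inequality:
  assumes hol: "g holomorphic_on {z. Im z > 0}"
    and pos: "\<And>z. Im z > 0 \<Longrightarrow> Im (g z) > 0"
    and T: "filterlim T at_top sequentially"
    and lim: "(\<lambda>j. g (\<i> * of_real (T j)) / of_real (T j)) \<longlonglongrightarrow> \<zeta>"
    and \<zeta>: "Im \<zeta> > 0"
  shows "Re \<zeta> = 0" and "\<And>z. Im z > 0 \<Longrightarrow> Im \<zeta> * Im z \<le> Im (g z)"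
proof -
  define u where "u j = g (\<i> * of_real (T j)) / of_real (T j)" for j
  have u: "u \<longlonglongrightarrow> \<zeta>" using lim unfolding u_def .
  have Tpos: "\<forall>\<^sub>F j in sequentially. T j > 0"
    using T by (auto simp: filterlim_at_top_dense)
  have inv: "(\<lambda>j. 1 / complex_of_real (T j)) \<longlonglongrightarrow> 0"
    using tendsto_of_real[OF tendsto_inverse_0_at_top[OF T], where ?'a = complex]
    by (simp add: inverse_eq_divide)
  have bound: "norm \<zeta> ^ 2 * Im z \<le> Im (g z) * Im \<zeta>" if z: "Im z > 0" for z
  proof (rule tendsto_le[OF sequentially_bot])
    show "(\<lambda>j. norm (g z * (1 / of_real (T j)) - u j) ^ 2 * Im z) \<longlonglongrightarrow> norm \<zeta> ^ 2 * Im z"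
    proof -
      have "(\<lambda>j. norm (g z * (1 / of_real (T j)) - u j) ^ 2 * Im z) \<longlonglongrightarrow> norm (g z * 0 - \<zeta>) ^ 2 * Im z"
        by (intro tendsto_intros inv u)
      thus ?thesis by simp
    qed
    show "(\<lambda>j. norm (z * (1 / of_real (T j)) - \<i>) ^ 2 * (Im (g z) * Im (u j)))
        \<longlonglongrightarrow> Im (g z) * Im \<zeta>"
    proof -
      have "(\<lambda>j. norm (z * (1 / of_real (T j)) - \<i>) ^ 2 * (Im (g z) * Im (u j)))
          \<longlonglongrightarrow> norm (z * 0 - \<i>) ^ 2 * (Im (g z) * Im \<zeta>)"
        by (intro tendsto_intros inv u)
      thus ?thesis by simp
    qed
    show "\<forall>\<^sub>F j in sequentially. norm (g z * (1 / of_real (T j)) - u j) ^ 2 * Im z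
        \<le> norm (z * (1 / of_real (T j)) - \<i>) ^ 2 * (Im (g z) * Im (u j))"
      using Tpos
    proof eventually_elim
      case (elim j)
      let ?T = "complex_of_real (T j)"
      have g: "g (\<i> * ?T) = ?T * u j" using elim by (simp add: u_def)
      have 1: "g z - ?T * u j = ?T * (g z * (1 / ?T) - u j)" "z - \<i> * ?T = ?T * (z * (1 / ?T) - \<i>)"
        using elim by (auto simp: field_simps)
      have "norm (g z - ?T * u j) ^ 2 * (Im z * T j)
          \<le> norm (z - \<i> * ?T) ^ 2 * (Im (g z) * (T j * Im (u j)))"
        using Schwarz_Pick_half_plane[OF hol pos z, of "\<i> * ?T"] elim g by simp
      \<comment> \<open>Two of the three factors \<open>T j\<close> come from the squared distances,
        the third from the imaginary parts at the far point.\<close>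
      hence "(T j) ^ 3 * (norm (g z * (1 / ?T) - u j) ^ 2 * Im z)
          \<le> (T j) ^ 3 * (norm (z * (1 / ?T) - \<i>) ^ 2 * (Im (g z) * Im (u j)))"
        unfolding 1 norm_mult power_mult_distrib using elim
        by (simp add: power2_eq_square power3_eq_cube mult_ac)
      thus ?case using elim by simp
    qed
  qed
  \<comment> \<open>Here \<open>bound\<close> is applied at the points
    \<open>\<i> * of_real (T j)\<close> themselves and divided by \<open>T j\<close>. In the limit
    it leaves no room for a real part of \<open>\<zeta>\<close>.\<close>
  have "norm \<zeta> ^ 2 \<le> Im \<zeta> * Im \<zeta>"
  proof (rule tendsto_le[OF sequentially_bot])
    show "(\<lambda>j. Im (u j) * Im \<zeta>) \<longlonglongrightarrow> Im \<zeta> * Im \<zeta>"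
      by (intro tendsto_intros u)
    show "(\<lambda>j. norm \<zeta> ^ 2) \<longlonglongrightarrow> norm \<zeta> ^ 2" by simp
    show "\<forall>\<^sub>F j in sequentially. norm \<zeta> ^ 2 \<le> Im (u j) * Im \<zeta>"
      using Tpos
    proof eventually_elim
      case (elim j)
      from bound[of "\<i> * of_real (T j)"] elim show ?case
        by (simp add: u_def Im_divide_of_real field_simps)
    qed
  qed
  hence "Re \<zeta> ^ 2 \<le> 0" unfolding cmod_power2 by (simp add: power2_eq_square)
  thus Re0: "Re \<zeta> = 0" by simp
  show "Im \<zeta> * Im z \<le> Im (g z)" if "Im z > 0" for z
  proof -
    have "Im \<zeta> * (Im \<zeta> * Im z) \<le> Im \<zeta> * Im (g z)"
      using bound[OF that] Re0 unfolding cmod_power2 by (simp add: power2_eq_square mult_ac)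
    thus ?thesis using \<zeta> by simp
  qed
qed

text \<open>The Schwarz--Pick inequality on the complex line through \<^term>\<open>p\<close> and \<^term>\<open>q\<close>, of which
  the half-space contains a disc of radius \<^term>\<open>1 / \<epsilon>\<close> times the distance of the two points.\<close>

lemma half_space_Schwarz_Pick:
  assumes F: "holomorphic_several F upper_half_space"
    and F_maps: "F ` upper_half_space \<subseteq> upper_half_plane"
    and p: "p \<in> upper_half_space" and \<epsilon>: "0 \<le> \<epsilon>" "\<epsilon> < 1"
    and close: "\<And>k. norm (q $ k - p $ k) \<le> \<epsilon> * Im (p $ k)"
  shows "(1 - \<epsilon>) * norm (F q - F p) \<le> 2 * \<epsilon> * Im (F p)"
proof (cases "\<epsilon> = 0")
  case True
  hence "q = p" using close by (auto simp: vec_eq_iff)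
  thus ?thesis using True by simp
next
  case False
  define v where "v = (1 / complex_of_real \<epsilon>) *s (q - p)"
  have mem: "p + l *s v \<in> upper_half_space" if l: "norm l < 1" for l
    unfolding upper_half_space_def upper_half_plane_def
  proof safe
    fix k
    have pk: "Im (p $ k) > 0" using p by (auto simp: upper_half_space_def upper_half_plane_def)
    have "norm (v $ k) \<le> Im (p $ k)"
      using close[of k] False \<epsilon> by (simp add: v_def norm_divide field_simps)
    hence "norm (l * v $ k) \<le> norm l * Im (p $ k)"
      unfolding norm_mult by (intro mult_left_mono) auto
    also have "\<dots> < Im (p $ k)" using l pk by simp
    finally have "norm (l * v $ k) < Im (p $ k)" .
    thus "0 < Im ((p + l *s v) $ k)"
      using abs_Im_le_cmod[of "l * v $ k"] by simp
  qed
  have "(\<lambda>l. F (p + l *s v)) holomorphic_on ball 0 1"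
    by (rule holomorphic_on_subset[OF holomorphic_several_on_line[OF F]]) (use mem in auto)
  moreover have "Im (F (p + l *s v)) > 0" if "norm l < 1" for l
    using F_maps mem[OF that] by (auto simp: upper_half_plane_def)
  ultimately have "norm (F (p + complex_of_real \<epsilon> *s v) - F (p + 0 *s v))
      \<le> norm (complex_of_real \<epsilon>) * norm (F (p + complex_of_real \<epsilon> *s v) - cnj (F (p + 0 *s v)))"
    by (rule Schwarz_Pick_disc) (use \<epsilon> in auto)
  moreover have "p + complex_of_real \<epsilon> *s v = q" "p + 0 *s v = p"
    using False by (auto simp: v_def vec_eq_iff)
  ultimately have cross: "norm (F q - F p) \<le> \<epsilon> * norm (F q - cnj (F p))"
    using \<epsilon> by simp
  \<comment> \<open>Substituted into \<open>cross\<close>, this yields a term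
    \<open>\<epsilon> * norm (F q - F p)\<close> that is absorbed on the left, whence the factor
    \<open>1 - \<epsilon>\<close>.\<close>
  have "norm (F q - cnj (F p)) \<le> norm (F q - F p) + norm (F p - cnj (F p))"
    using norm_triangle_ineq[of "F q - F p" "F p - cnj (F p)"] by simp
  also have "norm (F p - cnj (F p)) = 2 * Im (F p)"
    using F_maps p by (auto simp: complex_diff_cnj upper_half_plane_def norm_mult)
  finally have "norm (F q - cnj (F p)) \<le> norm (F q - F p) + 2 * Im (F p)" .
  from mult_left_mono[OF this \<epsilon>(1)] cross show ?thesis by (simp add: algebra_simps)
qed

text \<open>Equicontinuity at \<open>p\<close>: by Schwarz-Pick, \<open>F j (q j)\<close> and
  \<open>F j p\<close> differ by at most a null sequence times \<open>Im (F j p)\<close>, which is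
  bounded because it converges.\<close>

lemma half_space_limit_moving_point:
  assumes F: "\<forall>\<^sub>F j in sequentially. holomorphic_several (F j) upper_half_space \<and>
      F j ` upper_half_space \<subseteq> upper_half_plane"
    and p: "p \<in> upper_half_space" and q: "q \<longlonglongrightarrow> p" and lim: "(\<lambda>j. F j p) \<longlonglongrightarrow> l"
  shows "(\<lambda>j. F j (q j)) \<longlonglongrightarrow> l"
proof -
  \<comment> \<open>Dividing by the smallest imaginary part turns the distance of \<open>q j\<close>
    from \<open>p\<close> into one relative bound valid in every coordinate.\<close>
  define m where "m = Min (range (\<lambda>k. Im (p $ k)))"
  have m: "m \<le> Im (p $ k)" for k by (simp add: m_def)
  have m0: "m > 0"
    using p unfolding m_def by (subst Min_gr_iff) (auto simp: upper_half_space_def upper_half_plane_def)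
  define \<epsilon> where "\<epsilon> j = norm (q j - p) / m" for j
  have \<epsilon>: "\<epsilon> \<longlonglongrightarrow> 0"
    unfolding \<epsilon>_def using tendsto_divide[OF tendsto_norm[OF tendsto_diff[OF q tendsto_const[of p]]] tendsto_const[of m]] m0
    by simp
  have "\<forall>\<^sub>F j in sequentially. norm (F j (q j) - F j p) \<le> 2 * \<epsilon> j * Im (F j p) / (1 - \<epsilon> j)"
    using F order_tendstoD(2)[OF \<epsilon> zero_less_one]
  proof eventually_elim
    case (elim j)
    have "norm (q j $ k - p $ k) \<le> \<epsilon> j * Im (p $ k)" for k
    proof -
      have "norm (q j $ k - p $ k) \<le> norm (q j - p)"
        using Finite_Cartesian_Product.norm_nth_le[of "q j - p" k] by simp
      also have "\<dots> = \<epsilon> j * m" using m0 by (simp add: \<epsilon>_def)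
      also have "\<dots> \<le> \<epsilon> j * Im (p $ k)" using m m0 by (intro mult_left_mono) (auto simp: \<epsilon>_def)
      finally show ?thesis .
    qed
    hence "(1 - \<epsilon> j) * norm (F j (q j) - F j p) \<le> 2 * \<epsilon> j * Im (F j p)"
      using elim m0 by (intro half_space_Schwarz_Pick[OF _ _ p]) (auto simp: \<epsilon>_def)
    thus ?case using elim by (simp add: field_simps)
  qed
  moreover have "(\<lambda>j. 2 * \<epsilon> j * Im (F j p) / (1 - \<epsilon> j)) \<longlonglongrightarrow> 0"
  proof -
    have "(\<lambda>j. 2 * \<epsilon> j * Im (F j p) / (1 - \<epsilon> j)) \<longlonglongrightarrow> 2 * 0 * Im l / (1 - 0)"
      by (intro tendsto_intros \<epsilon> lim) simp
    thus ?thesis by simp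
  qed
  ultimately have "(\<lambda>j. F j (q j) - F j p) \<longlonglongrightarrow> 0"
    by (rule Lim_null_comparison)
  from tendsto_add[OF this lim] show ?thesis by simp
qed

section \<open>Real and imaginary parts, identity theorem, rescaling\<close>

definition of_real_vec :: "real ^ 'n \<Rightarrow> complex ^ 'n" where
  "of_real_vec x = (\<chi> k. complex_of_real (x $ k))"

lemma of_real_vec_nth [simp]: "of_real_vec x $ k = complex_of_real (x $ k)"
  by (simp add: of_real_vec_def)

lemma real_imag_decomposition:
  obtains x y where "z = of_real_vec x + \<i> *s of_real_vec y"
proof
  show "z = of_real_vec (\<chi> k. Re (z $ k)) + \<i> *s of_real_vec (\<chi> k. Im (z $ k))"
    by (auto simp: vec_eq_iff complex_eq_iff)
qed

text \<open>On the complex line through \<open>\<i> *s of_real_vec y\<close> in the direction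
  \<open>of_real_vec x\<close>, the parameter 1 gives \<open>z\<close>, while purely imaginary
  parameters give purely imaginary points. There \<open>F\<close> and \<open>G\<close> agree, and 0
  is a limit point of such parameters.\<close>

lemma half_space_identity:
  assumes F: "holomorphic_several F upper_half_space" and G: "holomorphic_several G upper_half_space"
    and eq: "\<And>y. (\<And>k. y $ k > 0) \<Longrightarrow> F (\<i> *s of_real_vec y) = G (\<i> *s of_real_vec y)"
    and z: "z \<in> upper_half_space"
  shows "F z = G z"
proof -
  obtain x y where xy: "z = of_real_vec x + \<i> *s of_real_vec y"
    by (rule real_imag_decomposition)
  define p where "p = \<i> *s of_real_vec y"
  define v where "v = of_real_vec x"
  define S where "S = {l. p + l *s v \<in> upper_half_space}"
  define \<phi> where "\<phi> l = F (p + l *s v) - G (p + l *s v)" for l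
  have S: "open S" "connected S"
    unfolding S_def by (intro open_line_preimage convex_connected convex_line_preimage)+
  have 0: "0 \<in> S" and 1: "1 \<in> S"
    using z by (auto simp: S_def p_def v_def xy in_upper_half_space_iff)
  define U where "U = {l \<in> S. Re l = 0}"
  have "\<phi> 1 = 0"
  proof (rule analytic_continuation[OF _ S _ 0 _ _ 1])
    show "\<phi> holomorphic_on S"
      unfolding \<phi>_def S_def by (intro holomorphic_intros holomorphic_several_on_line F G)
    show "U \<subseteq> S" by (auto simp: U_def)
    show "0 islimpt U"
      unfolding islimpt_approachable
    proof safe
      fix e :: real assume "e > 0"
      obtain d where d: "d > 0" "ball 0 d \<subseteq> S" using S(1) 0 open_contains_ball by blast
      define r where "r = min d e / 2"
      have "r > 0" "r < d" "r < e" using d \<open>e > 0\<close> by (auto simp: r_def min_def)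
      hence "\<i> * of_real r \<in> U" "\<i> * of_real r \<noteq> 0" "dist (\<i> * of_real r) 0 < e"
        using d by (auto simp: U_def norm_mult intro!: subsetD[OF d(2)])
      thus "\<exists>x'\<in>U. x' \<noteq> 0 \<and> dist x' 0 < e" by blast
    qed
    fix l assume l: "l \<in> U"
    have "p + l *s v = \<i> *s of_real_vec (y + Im l *\<^sub>R x)"
      using l by (auto simp: vec_eq_iff complex_eq_iff p_def v_def U_def)
    moreover have "(y + Im l *\<^sub>R x) $ k > 0" for k
      using l unfolding U_def S_def by (auto simp: in_upper_half_space_iff p_def v_def)
    ultimately show "\<phi> l = 0"
      using eq[of "y + Im l *\<^sub>R x"] by (simp add: \<phi>_def)
  qed
  moreover have "p + 1 *s v = z" by (simp add: p_def v_def xy)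
  ultimately show ?thesis by (simp add: \<phi>_def)
qed

lemma scaleR_in_half_space:
  "z \<in> upper_half_space \<Longrightarrow> r > 0 \<Longrightarrow> r *\<^sub>R z \<in> (upper_half_space :: (complex ^ 'n) set)"
  by (simp add: in_upper_half_space_iff)

lemma real_shift_in_half_space:
  "z \<in> upper_half_space \<Longrightarrow> z + complex_of_real s *s 1 \<in> (upper_half_space :: (complex ^ 'n) set)"
  by (simp add: in_upper_half_space_iff)

lemma slice_in_half_space:
  assumes "\<And>k. y $ k > 0" "Im l > 0"
  shows "of_real_vec x + l *s of_real_vec y \<in> upper_half_space"
  using assms by (simp add: in_upper_half_space_iff)

text \<open>The factors \<open>r\<close> and \<open>1 / r\<close> cancel, so the derivative at
  \<open>z\<close> is that of \<open>F\<close> at \<open>r *\<^sub>R z\<close>.\<close>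

lemma holomorphic_several_rescale:
  fixes F :: "complex ^ 'n \<Rightarrow> complex"
  assumes F: "holomorphic_several F upper_half_space" and r: "r > 0"
  shows "holomorphic_several (\<lambda>z. complex_of_real (1 / r) * F (r *\<^sub>R z)) upper_half_space"
  unfolding holomorphic_several_def
proof
  fix z :: "complex ^ 'n" assume z: "z \<in> upper_half_space"
  then obtain D where D: "(F has_derivative D) (at (r *\<^sub>R z) within upper_half_space)"
      and s: "\<And>a v. D (a *s v) = a * D v"
    using F scaleR_in_half_space[OF z r] unfolding holomorphic_several_def by blast
  have lin: "linear D" using D has_derivative_linear by blast
  have "((\<lambda>z. F (r *\<^sub>R z)) has_derivative (\<lambda>v. D (r *\<^sub>R v))) (at z within upper_half_space)"
  proof (rule has_derivative_in_compose[where f = "\<lambda>z. r *\<^sub>R z" and g = F])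
    show "((\<lambda>z. r *\<^sub>R z) has_derivative (\<lambda>v. r *\<^sub>R v)) (at z within upper_half_space)"
      by (auto intro!: derivative_eq_intros)
    show "(F has_derivative D) (at (r *\<^sub>R z) within (\<lambda>z. r *\<^sub>R z) ` upper_half_space)"
      by (rule has_derivative_subset[OF D]) (auto intro: scaleR_in_half_space r)
  qed
  hence "((\<lambda>z. complex_of_real (1 / r) * F (r *\<^sub>R z)) has_derivative
      (\<lambda>v. complex_of_real (1 / r) * D (r *\<^sub>R v))) (at z within upper_half_space)"
    by (rule has_derivative_mult_right)
  moreover have "(\<lambda>v. complex_of_real (1 / r) * D (r *\<^sub>R v)) = D"
    using r linear_scale[OF lin] by (auto simp: scaleR_conv_of_real)
  ultimately show "\<exists>D. ((\<lambda>z. complex_of_real (1 / r) * F (r *\<^sub>R z)) has_derivative D)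
      (at z within upper_half_space) \<and> (\<forall>a v. D (a *s v) = a * D v)"
    using s by auto
qed

section \<open>The limit map and its translations\<close>

locale half_space_rescaling =
  fixes f h :: "complex ^ 'n \<Rightarrow> complex" and c :: real and t :: "nat \<Rightarrow> real"
  assumes f_holomorphic: "holomorphic_several f upper_half_space"
    and f_maps: "f ` upper_half_space \<subseteq> upper_half_plane"
    and c_pos: "c > 0"
    and f_shift: "\<And>z. z \<in> upper_half_space \<Longrightarrow>
          f (\<chi> k. z $ k + complex_of_real c) = f z + complex_of_real c"
    and t_lim: "filterlim t at_top sequentially"
    and h_holomorphic: "holomorphic_several h upper_half_space"
    and h_maps: "h ` upper_half_space \<subseteq> upper_half_plane"
    and h_lim: "\<And>z. z \<in> upper_half_space \<Longrightarrow>
          (\<lambda>j. complex_of_real (1 / t j) * f (t j *\<^sub>R z)) \<longlonglongrightarrow> h z"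
begin

lemma f_pos: "z \<in> upper_half_space \<Longrightarrow> Im (f z) > 0"
  using f_maps by (auto simp: upper_half_plane_def)

lemma h_pos: "z \<in> upper_half_space \<Longrightarrow> Im (h z) > 0"
  using h_maps by (auto simp: upper_half_plane_def)

lemma t_eventually_pos: "\<forall>\<^sub>F j in sequentially. t j > 0"
  using t_lim by (auto simp: filterlim_at_top_dense)

lemma h_lim_moving_point:
  assumes p: "p \<in> upper_half_space" and q: "q \<longlonglongrightarrow> p"
  shows "(\<lambda>j. complex_of_real (1 / t j) * f (t j *\<^sub>R q j)) \<longlonglongrightarrow> h p"
proof (rule half_space_limit_moving_point[where
      F = "\<lambda>j z. complex_of_real (1 / t j) * f (t j *\<^sub>R z)", OF _ p q h_lim[OF p]])
  show "\<forall>\<^sub>F j in sequentially.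
      holomorphic_several (\<lambda>z. complex_of_real (1 / t j) * f (t j *\<^sub>R z)) upper_half_space \<and>
      (\<lambda>z. complex_of_real (1 / t j) * f (t j *\<^sub>R z)) ` upper_half_space \<subseteq> upper_half_plane"
    using t_eventually_pos
  proof eventually_elim
    case (elim j)
    show ?case
      using holomorphic_several_rescale[OF f_holomorphic elim] f_pos[OF scaleR_in_half_space[OF _ elim]] elim
      by (auto simp: upper_half_plane_def Im_divide_of_real)
  qed
qed

lemma f_shift_nat:
  assumes z: "z \<in> upper_half_space"
  shows "f (z + complex_of_real (real m * c) *s 1) = f z + complex_of_real (real m * c)"
proof (induction m)
  case 0
  have "z + 0 *s 1 = z" by simp
  thus ?case by simp
next
  case (Suc m)
  have "z + complex_of_real (real (Suc m) * c) *s 1 =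
      (\<chi> k. (z + complex_of_real (real m * c) *s 1) $ k + complex_of_real c)"
    by (auto simp: vec_eq_iff algebra_simps)
  hence "f (z + complex_of_real (real (Suc m) * c) *s 1) =
      f (z + complex_of_real (real m * c) *s 1) + complex_of_real c"
    using f_shift[OF real_shift_in_half_space[OF z]] by metis
  also have "\<dots> = f z + complex_of_real (real (Suc m) * c)"
    unfolding Suc.IH by (simp add: algebra_simps)
  finally show ?case .
qed

text \<open>The rescaled maps commute with shifts by multiples of \<open>c / t j\<close>. Such
  multiples approximate \<open>s\<close>, and the limit at moving points carries the relation over
  to \<open>h\<close>.\<close>

lemma h_real_shift:
  assumes z: "z \<in> upper_half_space" and s: "s \<ge> 0"
  shows "h (z + complex_of_real s *s 1) = h z + complex_of_real s"
proof -
  \<comment> \<open>Once \<open>t j\<close> is positive, this is the largest multiple of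
    \<open>c / t j\<close> not exceeding \<open>s\<close>; as \<open>s\<close> is nonnegative,
    \<open>nat\<close> truncates nothing.\<close>
  define d where "d j = real (nat \<lfloor>s * t j / c\<rfloor>) * c / t j" for j
  have d: "d \<longlonglongrightarrow> s"
  proof (rule tendsto_sandwich[of "\<lambda>j. s - c / t j" d _ "\<lambda>j. s"])
    show "\<forall>\<^sub>F j in sequentially. s - c / t j \<le> d j"
      using t_eventually_pos
    proof eventually_elim
      case (elim j)
      have "s * t j / c - 1 \<le> real (nat \<lfloor>s * t j / c\<rfloor>)"
        using s elim c_pos by linarith
      hence "(s * t j / c - 1) * (c / t j) \<le> d j"
        unfolding d_def times_divide_eq_right[symmetric] mult.assoc
        using elim c_pos by (intro mult_right_mono) auto
      moreover have "(s * t j / c - 1) * (c / t j) = s - c / t j"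
        using elim c_pos by (simp add: field_simps)
      ultimately show ?case by simp
    qed
    show "\<forall>\<^sub>F j in sequentially. d j \<le> s"
      using t_eventually_pos
    proof eventually_elim
      case (elim j)
      have "s * t j / c \<ge> 0" using s elim c_pos by simp
      hence "real (nat \<lfloor>s * t j / c\<rfloor>) \<le> s * t j / c" by linarith
      thus ?case using elim c_pos by (simp add: d_def field_simps)
    qed
    have "(\<lambda>j. s - c * inverse (t j)) \<longlonglongrightarrow> s - c * 0"
      by (intro tendsto_intros tendsto_inverse_0_at_top[OF t_lim])
    thus "(\<lambda>j. s - c / t j) \<longlonglongrightarrow> s" by (simp add: divide_inverse)
  qed auto
  have q: "(\<lambda>j. z + complex_of_real (d j) *s 1) \<longlonglongrightarrow> z + complex_of_real s *s 1"
    by (intro tendsto_add tendsto_const bounded_linear.tendsto[OF bounded_linear_vector_scale]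
        tendsto_of_real d)
  have "(\<lambda>j. complex_of_real (1 / t j) * f (t j *\<^sub>R z) + complex_of_real (d j))
      \<longlonglongrightarrow> h z + complex_of_real s"
    by (intro tendsto_add h_lim z tendsto_of_real d)
  moreover have "\<forall>\<^sub>F j in sequentially.
      complex_of_real (1 / t j) * f (t j *\<^sub>R z) + complex_of_real (d j) =
      complex_of_real (1 / t j) * f (t j *\<^sub>R (z + complex_of_real (d j) *s 1))"
    using t_eventually_pos
  proof eventually_elim
    case (elim j)
    have "t j *\<^sub>R (z + complex_of_real (d j) *s 1) =
        t j *\<^sub>R z + complex_of_real (real (nat \<lfloor>s * t j / c\<rfloor>) * c) *s 1"
      using elim by (auto simp: vec_eq_iff d_def complex_eq_iff algebra_simps)
    hence "f (t j *\<^sub>R (z + complex_of_real (d j) *s 1)) =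
        f (t j *\<^sub>R z) + complex_of_real (real (nat \<lfloor>s * t j / c\<rfloor>) * c)"
      using f_shift_nat[OF scaleR_in_half_space[OF z elim]] by metis
    thus ?case using elim by (simp add: d_def field_simps)
  qed
  ultimately have "(\<lambda>j. complex_of_real (1 / t j) * f (t j *\<^sub>R (z + complex_of_real (d j) *s 1)))
      \<longlonglongrightarrow> h z + complex_of_real s"
    by (rule Lim_transform_eventually)
  with h_lim_moving_point[OF real_shift_in_half_space[OF z] q] show ?thesis
    by (rule LIMSEQ_unique)
qed

text \<open>The shift relation is holomorphic in the shift \<open>l\<close> and holds for real
  \<open>l\<close> at least 0, so the identity theorem extends it to \<open>\<i>\<close>.\<close>

lemma h_imaginary_shift:
  assumes z: "z \<in> upper_half_space"
  shows "h (z + \<i> *s 1) = h z + \<i>"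
proof -
  define S where "S = {l. z + l *s 1 \<in> (upper_half_space :: (complex ^ 'n) set)}"
  define \<phi> where "\<phi> l = h (z + l *s 1) - l - h z" for l
  have S: "open S" "connected S"
    unfolding S_def by (intro open_line_preimage convex_connected convex_line_preimage)+
  have 0: "0 \<in> S" and i: "\<i> \<in> S"
    using z by (auto simp: S_def in_upper_half_space_iff add_pos_pos)
  have "\<phi> \<i> = 0"
  proof (rule analytic_continuation[OF _ S _ 0 _ _ i])
    show "\<phi> holomorphic_on S"
      unfolding \<phi>_def S_def by (intro holomorphic_intros holomorphic_several_on_line h_holomorphic)
    show "complex_of_real ` {0..} \<subseteq> S"
      using real_shift_in_half_space[OF z] by (auto simp: S_def)
    show "0 islimpt complex_of_real ` {0..}"
      unfolding islimpt_approachable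
    proof safe
      fix e :: real assume "e > 0"
      thus "\<exists>x'\<in>complex_of_real ` {0..}. x' \<noteq> 0 \<and> dist x' 0 < e"
        by (intro bexI[OF _ imageI[of "e / 2"]]) auto
    qed
    show "\<phi> l = 0" if "l \<in> complex_of_real ` {0..}" for l
      using that h_real_shift[OF z] by (auto simp: \<phi>_def)
  qed
  thus ?thesis by (simp add: \<phi>_def algebra_simps)
qed

section \<open>Julia's inequality on slices and homogeneity\<close>

text \<open>After rescaling, the offset \<open>x\<close> shrinks to \<open>x / t j\<close> and
  disappears in the limit. Hence every slice in direction \<open>y\<close> has the same limit
  \<open>h (\<i> *s of_real_vec y)\<close>, whatever \<open>x\<close> is.\<close>

lemma Julia_on_slice:
  assumes y: "\<And>k. y $ k > 0"
  shows "Re (h (\<i> *s of_real_vec y)) = 0"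
    and "\<And>l. Im l > 0 \<Longrightarrow>
      Im (h (\<i> *s of_real_vec y)) * Im l \<le> Im (f (of_real_vec x + l *s of_real_vec y))"
proof -
  define g where "g l = f (of_real_vec x + l *s of_real_vec y)" for l
  have iy: "\<i> *s of_real_vec y \<in> upper_half_space"
    using y by (simp add: in_upper_half_space_iff)
  have hol: "g holomorphic_on {l. Im l > 0}"
    unfolding g_def
    by (rule holomorphic_on_subset[OF holomorphic_several_on_line[OF f_holomorphic]])
       (use slice_in_half_space[OF y] in auto)
  have pos: "Im (g l) > 0" if "Im l > 0" for l
    unfolding g_def by (intro f_pos slice_in_half_space y that)
  have "(\<lambda>j. inverse (t j) *\<^sub>R of_real_vec x + \<i> *s of_real_vec y)
      \<longlonglongrightarrow> 0 *\<^sub>R of_real_vec x + \<i> *s of_real_vec y"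
    by (intro tendsto_intros tendsto_inverse_0_at_top[OF t_lim])
  hence "(\<lambda>j. complex_of_real (1 / t j) * f (t j *\<^sub>R (inverse (t j) *\<^sub>R of_real_vec x + \<i> *s of_real_vec y)))
      \<longlonglongrightarrow> h (\<i> *s of_real_vec y)"
    by (intro h_lim_moving_point iy) simp
  moreover have "\<forall>\<^sub>F j in sequentially.
      complex_of_real (1 / t j) * f (t j *\<^sub>R (inverse (t j) *\<^sub>R of_real_vec x + \<i> *s of_real_vec y)) =
      g (\<i> * complex_of_real (t j)) / complex_of_real (t j)"
    using t_eventually_pos
  proof eventually_elim
    case (elim j)
    have "t j *\<^sub>R (inverse (t j) *\<^sub>R of_real_vec x + \<i> *s of_real_vec y) =
        of_real_vec x + (\<i> * complex_of_real (t j)) *s of_real_vec y"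
      using elim by (auto simp: vec_eq_iff complex_eq_iff)
    thus ?case by (simp add: g_def)
  qed
  ultimately have lim: "(\<lambda>j. g (\<i> * complex_of_real (t j)) / complex_of_real (t j))
      \<longlonglongrightarrow> h (\<i> *s of_real_vec y)"
    by (rule Lim_transform_eventually)
  note Julia = Julia_inequality[OF hol pos t_lim lim h_pos[OF iy]]
  show "Re (h (\<i> *s of_real_vec y)) = 0" using Julia(1) by blast
  show "Im (h (\<i> *s of_real_vec y)) * Im l \<le> Im (f (of_real_vec x + l *s of_real_vec y))"
    if "Im l > 0" for l
    using Julia(2)[OF _ that] by (simp add: g_def)
qed

text \<open>Julia's inequality at \<open>l = \<i> * of_real (s * t j)\<close> with
  \<open>x = 0\<close>, divided by \<open>t j\<close>, passes to the limit.\<close>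

lemma h_superhomogeneous:
  assumes y: "\<And>k. y $ k > 0" and s: "s > 0"
  shows "s * Im (h (\<i> *s of_real_vec y)) \<le> Im (h (\<i> *s of_real_vec (s *\<^sub>R y)))"
proof (rule tendsto_lowerbound[OF tendsto_Im[OF h_lim]])
  show "\<i> *s of_real_vec (s *\<^sub>R y) \<in> upper_half_space"
    using y s by (simp add: in_upper_half_space_iff)
  show "\<forall>\<^sub>F j in sequentially. s * Im (h (\<i> *s of_real_vec y))
      \<le> Im (complex_of_real (1 / t j) * f (t j *\<^sub>R (\<i> *s of_real_vec (s *\<^sub>R y))))"
    using t_eventually_pos
  proof eventually_elim
    case (elim j)
    have "t j *\<^sub>R (\<i> *s of_real_vec (s *\<^sub>R y)) =
        of_real_vec 0 + (\<i> * complex_of_real (s * t j)) *s of_real_vec y"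
      by (auto simp: vec_eq_iff complex_eq_iff)
    hence "Im (h (\<i> *s of_real_vec y)) * (s * t j) \<le> Im (f (t j *\<^sub>R (\<i> *s of_real_vec (s *\<^sub>R y))))"
      using Julia_on_slice(2)[OF y, of "\<i> * complex_of_real (s * t j)" 0] s elim by simp
    thus ?case using elim by (simp add: Im_divide_of_real field_simps)
  qed
qed simp

text \<open>The reverse inequality is superhomogeneity at \<open>s *\<^sub>R y\<close> with factor
  \<open>1 / s\<close>; the real parts vanish on both sides.\<close>

lemma h_homogeneous:
  assumes y: "\<And>k. y $ k > 0" and s: "s > 0"
  shows "h (\<i> *s of_real_vec (s *\<^sub>R y)) = complex_of_real s * h (\<i> *s of_real_vec y)"
proof -
  have sy: "(s *\<^sub>R y) $ k > 0" for k using y s by simp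
  have "(1 / s) *\<^sub>R (s *\<^sub>R y) = y" using s by simp
  hence "1 / s * Im (h (\<i> *s of_real_vec (s *\<^sub>R y))) \<le> Im (h (\<i> *s of_real_vec y))"
    using h_superhomogeneous[OF sy, of "1 / s"] s by simp
  hence "Im (h (\<i> *s of_real_vec (s *\<^sub>R y))) \<le> s * Im (h (\<i> *s of_real_vec y))"
    using s by (simp add: field_simps)
  with h_superhomogeneous[OF y s] Julia_on_slice(1)[OF y] Julia_on_slice(1)[OF sy]
  show ?thesis by (simp add: complex_eq_iff)
qed

text \<open>By homogeneity and \<open>h (z + \<i> \<cdot> 1) = h z + \<i>\<close>, on purely imaginary points \<^term>\<open>h\<close> equals its
  difference quotients at \<open>\<i> \<cdot> 1\<close>, hence its derivative there.\<close>

lemma h_imaginary_eq_derivative: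
  assumes D: "(h has_derivative D) (at (\<i> *s 1))" and y: "\<And>k. y $ k > 0"
  shows "h (\<i> *s of_real_vec y) = D (\<i> *s of_real_vec y)"
proof -
  let ?p = "\<i> *s (1 :: complex ^ 'n)" and ?v = "\<i> *s of_real_vec y"
  have v: "?v \<in> upper_half_space" using y by (simp add: in_upper_half_space_iff)
  have scale: "r *\<^sub>R ?v = \<i> *s of_real_vec (r *\<^sub>R y)" for r
    by (auto simp: vec_eq_iff complex_eq_iff)
  have quot: "h (?p + r *\<^sub>R ?v) = complex_of_real r * h ?v + \<i>" if "r > 0" for r
    using h_imaginary_shift[OF scaleR_in_half_space[OF v that]] h_homogeneous[OF y that]
    by (simp add: scale add.commute)
  have ev0: "\<forall>\<^sub>F r :: real in at_right 0. r > 0"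
    by (rule eventually_at_right_less)
  have line: "((\<lambda>r. ?p + r *\<^sub>R ?v) has_derivative (\<lambda>r. r *\<^sub>R ?v)) (at 0)"
    by (auto intro!: derivative_eq_intros)
  have D': "(h has_derivative D) (at (?p + 0 *\<^sub>R ?v))" using D by simp
  have der: "((\<lambda>r. h (?p + r *\<^sub>R ?v)) has_derivative (\<lambda>r. D (r *\<^sub>R ?v))) (at 0)"
    by (rule has_derivative_compose[OF line D'])
  have "linear D" using D has_derivative_linear by blast
  hence "(\<lambda>r. D (r *\<^sub>R ?v)) = (\<lambda>r. r *\<^sub>R D ?v)" by (auto simp: linear_scale)
  with der have vder: "((\<lambda>r. h (?p + r *\<^sub>R ?v)) has_vector_derivative D ?v) (at 0)"
    by (simp add: has_vector_derivative_def)
  \<comment> \<open>Continuity at 0 and the formula \<open>quot\<close> for positive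
    \<open>r\<close> determine the value at the base point: \<open>h ?p = \<i>\<close>.\<close>
  have cont: "((\<lambda>r. h (?p + r *\<^sub>R ?v)) \<longlongrightarrow> h (?p + 0 *\<^sub>R ?v)) (at_right 0)"
    using has_derivative_continuous[OF der] unfolding continuous_within
    by (rule tendsto_within_subset) simp
  have "((\<lambda>r. complex_of_real r * h ?v + \<i>) \<longlongrightarrow> of_real 0 * h ?v + \<i>) (at_right 0)"
    by (intro tendsto_intros)
  moreover have "\<forall>\<^sub>F r in at_right 0. complex_of_real r * h ?v + \<i> = h (?p + r *\<^sub>R ?v)"
    using ev0 by eventually_elim (rule quot[symmetric])
  ultimately have "((\<lambda>r. h (?p + r *\<^sub>R ?v)) \<longlongrightarrow> of_real 0 * h ?v + \<i>) (at_right 0)"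
    by (rule Lim_transform_eventually)
  with cont have "h (?p + 0 *\<^sub>R ?v) = of_real 0 * h ?v + \<i>"
    by (rule tendsto_unique[OF trivial_limit_at_right_real])
  hence hp: "h ?p = \<i>" by simp
  \<comment> \<open>The formula holds only for \<open>r \<ge> 0\<close>, so the derivatives are
    compared within \<open>{0..}\<close>, where they are still unique.\<close>
  have "((\<lambda>r. complex_of_real r * h ?v + \<i>) has_vector_derivative h ?v) (at 0 within {0..})"
    by (auto intro!: derivative_eq_intros)
  moreover have "((\<lambda>r. complex_of_real r * h ?v + \<i>) has_vector_derivative D ?v) (at 0 within {0..})"
  proof (rule has_vector_derivative_transform[OF _ _ has_vector_derivative_at_within[OF vder]])
    show "complex_of_real r * h ?v + \<i> = h (?p + r *\<^sub>R ?v)" if "r \<in> {0..}" for r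
      using that quot[of r] hp by (cases "r = 0") auto
  qed simp
  ultimately show ?thesis
    by (intro vector_derivative_unique_within) (auto simp: at_within_Ici_at_right)
qed

section \<open>Linearity of the limit map\<close>

text \<open>\<open>D\<close> is the derivative of \<open>h\<close> at \<open>\<i> *s 1\<close>.
  Being linear it is its own derivative, hence holomorphic, and agreement on the purely imaginary
  points spreads to the half-space.\<close>

lemma h_linear:
  obtains D where "\<And>z. z \<in> upper_half_space \<Longrightarrow> h z = D z" "linear D" "\<And>a v. D (a *s v) = a * D v"
proof -
  have p: "\<i> *s 1 \<in> (upper_half_space :: (complex ^ 'n) set)"
    by (simp add: in_upper_half_space_iff)
  then obtain D where D: "(h has_derivative D) (at (\<i> *s 1) within upper_half_space)"
      and s: "\<And>a v. D (a *s v) = a * D v"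
    using h_holomorphic unfolding holomorphic_several_def by blast
  hence D': "(h has_derivative D) (at (\<i> *s 1))"
    using at_within_open[OF p open_upper_half_space] by simp
  have "holomorphic_several D upper_half_space"
    unfolding holomorphic_several_def
    using s bounded_linear_imp_has_derivative[OF has_derivative_bounded_linear[OF D']] by blast
  hence "h z = D z" if "z \<in> upper_half_space" for z
    using half_space_identity[OF h_holomorphic _ h_imaginary_eq_derivative[OF D'] that] by blast
  thus thesis using that has_derivative_linear[OF D'] s by blast
qed

lemma linear_on_half_space: "linear_on_upper_half_space h"
proof -
  obtain D where D: "\<And>z. z \<in> upper_half_space \<Longrightarrow> h z = D z" "linear D" "\<And>a v. D (a *s v) = a * D v"
    using h_linear by blast
  have "D z = (\<Sum>k\<in>UNIV. (\<chi> k. D (axis k 1)) $ k * z $ k)" for z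
  proof -
    have "D z = D (\<Sum>k\<in>UNIV. z $ k *s axis k 1)" by (simp add: basis_expansion)
    also have "\<dots> = (\<Sum>k\<in>UNIV. D (z $ k *s axis k 1))" by (rule linear_sum[OF D(2)])
    finally show ?thesis by (simp add: D(3) mult.commute)
  qed
  thus ?thesis
    using D(1) unfolding linear_on_upper_half_space_def by metis
qed

section \<open>Comparison of \<open>f\<close> with \<open>h\<close>\<close>

text \<open>The linear map \<open>D\<close> is real on real vectors: its values at
  \<open>\<i> *s of_real_vec 1\<close> and at the nearby point
  \<open>\<i> *s of_real_vec (1 + r *\<^sub>R x)\<close> are both purely imaginary.\<close>

lemma Im_h:
  assumes y: "\<And>k. y $ k > 0"
  shows "Im (h (of_real_vec x + \<i> *s of_real_vec y)) = Im (h (\<i> *s of_real_vec y))"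
proof -
  obtain D where D: "\<And>z. z \<in> upper_half_space \<Longrightarrow> h z = D z" "linear D" "\<And>a v. D (a *s v) = a * D v"
    using h_linear by blast
  \<comment> \<open>Small enough that \<open>1 + r *\<^sub>R x\<close> has positive
    coordinates.\<close>
  define r where "r = 1 / (norm x + 1)"
  have r: "r > 0" by (simp add: r_def add_nonneg_pos)
  have Re0: "Re (D (\<i> *s of_real_vec w)) = 0" if w: "\<And>k. w $ k > 0" for w
    using Julia_on_slice(1)[OF w] D(1)[of "\<i> *s of_real_vec w"] w
    by (simp add: in_upper_half_space_iff)
  have pos: "(1 + r *\<^sub>R x) $ k > 0" for k
  proof -
    have "\<bar>x $ k\<bar> < norm x + 1" using component_le_norm_cart[of x k] by simp
    hence "r * \<bar>x $ k\<bar> < 1" by (simp add: r_def field_simps)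
    moreover have "r * \<bar>x $ k\<bar> = \<bar>r * x $ k\<bar>" using r by (simp add: abs_mult)
    ultimately show ?thesis by simp
  qed
  have "\<i> *s of_real_vec (1 + r *\<^sub>R x) = \<i> *s of_real_vec 1 + (\<i> * complex_of_real r) *s of_real_vec x"
    by (auto simp: vec_eq_iff algebra_simps)
  hence "D (\<i> *s of_real_vec (1 + r *\<^sub>R x)) =
      D (\<i> *s of_real_vec 1) + \<i> * complex_of_real r * D (of_real_vec x)"
    using linear_add[OF D(2)] D(3) by metis
  hence "Im (D (of_real_vec x)) = 0"
    using Re0[OF pos] Re0[of 1] r by simp
  thus ?thesis
    using D(1)[OF slice_in_half_space[OF y, of \<i> x]] D(1)[OF slice_in_half_space[OF y, of \<i> 0]]
      linear_add[OF D(2)]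
    by (simp add: of_real_vec_def zero_vec_def[symmetric])
qed

text \<open>Julia's inequality on the slice through \<open>z\<close>, taken at
  \<open>l = \<i>\<close>; \<open>Im_h\<close> restores the real part of \<open>z\<close> in the
  argument of \<open>h\<close>.\<close>

lemma Im_h_le_Im_f:
  assumes z: "z \<in> upper_half_space"
  shows "Im (h z) \<le> Im (f z)"
proof -
  obtain x y where xy: "z = of_real_vec x + \<i> *s of_real_vec y"
    by (rule real_imag_decomposition)
  have y: "y $ k > 0" for k using z by (simp add: xy in_upper_half_space_iff)
  show ?thesis
    using Julia_on_slice(2)[OF y, of \<i> x] by (simp add: xy Im_h[OF y])
qed

text \<open>On the complex line through \<open>w\<close> and \<open>z\<close>, the difference has
  nonnegative imaginary part and attains 0 at \<open>w\<close>. A nonconstant difference would have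
  open image and so reach below the real axis.\<close>

lemma f_minus_h_constant:
  assumes w: "w \<in> upper_half_space" and eq: "Im (f w - h w) = 0" and z: "z \<in> upper_half_space"
  shows "f z - h z = f w - h w"
proof -
  define S where "S = {l. w + l *s (z - w) \<in> upper_half_space}"
  define \<phi> where "\<phi> l = f (w + l *s (z - w)) - h (w + l *s (z - w))" for l
  have S: "open S" "connected S"
    unfolding S_def by (intro open_line_preimage convex_connected convex_line_preimage)+
  have 0: "0 \<in> S" and 1: "1 \<in> S"
    using w z by (auto simp: S_def)
  have "\<phi> constant_on S"
  proof (rule ccontr)
    assume nc: "\<not> \<phi> constant_on S"
    have "\<phi> holomorphic_on S"
      unfolding \<phi>_def S_def
      by (intro holomorphic_intros holomorphic_several_on_line f_holomorphic h_holomorphic)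
    hence "open (\<phi> ` S)"
      by (rule open_mapping_thm[OF _ S S(1) subset_refl nc])
    then obtain e where e: "e > 0" "ball (\<phi> 0) e \<subseteq> \<phi> ` S"
      using 0 open_contains_ball by blast
    have "\<phi> 0 - \<i> * complex_of_real (e / 2) \<in> ball (\<phi> 0) e"
      using e by (simp add: dist_norm norm_mult)
    then obtain l where l: "l \<in> S" "\<phi> l = \<phi> 0 - \<i> * complex_of_real (e / 2)"
      using e(2) by (metis (no_types, lifting) imageE subsetD)
    have "Im (\<phi> l) \<ge> 0"
      using l(1) Im_h_le_Im_f by (simp add: \<phi>_def S_def)
    moreover have "Im (\<phi> l) = - e / 2"
      using eq by (simp add: l(2)) (simp add: \<phi>_def)
    ultimately show False using e(1) by simp
  qed
  hence "\<phi> 1 = \<phi> 0" using 0 1 unfolding constant_on_def by metis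
  thus ?thesis by (simp add: \<phi>_def)
qed

end

theorem theorem2:
  fixes f h :: "complex ^ 'n \<Rightarrow> complex"
    and c :: real
    and t :: "nat \<Rightarrow> real"
  assumes f_holomorphic: "holomorphic_several f upper_half_space"
    and f_maps: "f ` upper_half_space \<subseteq> upper_half_plane"
    and c_pos: "c > 0"
    and f_shift: "\<And>z. z \<in> upper_half_space \<Longrightarrow>
          f (\<chi> k. z $ k + complex_of_real c) = f z + complex_of_real c"
    and t_pos: "\<And>j. j \<ge> 1 \<Longrightarrow> t j > 0"
    and t_lim: "filterlim t at_top sequentially"
    and h_holomorphic: "holomorphic_several h upper_half_space"
    and h_maps: "h ` upper_half_space \<subseteq> upper_half_plane"
    and h_lim: "\<And>z. z \<in> upper_half_space \<Longrightarrow>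
          (\<lambda>j. complex_of_real (1 / t j) * f (t j *\<^sub>R z)) \<longlonglongrightarrow> h z"
  shows "linear_on_upper_half_space h \<and>
    ((\<exists>w\<in>upper_half_space. Im (f w - h w) = 0) \<longrightarrow>
      (\<exists>\<alpha>::real. \<forall>z\<in>upper_half_space. f z = h z + complex_of_real \<alpha>))"
proof -
  interpret half_space_rescaling f h c t
    by unfold_locales
      (use f_holomorphic f_maps c_pos f_shift t_lim h_holomorphic h_maps h_lim in auto)
  have "\<exists>\<alpha>::real. \<forall>z\<in>upper_half_space. f z = h z + complex_of_real \<alpha>"
    if w: "w \<in> upper_half_space" "Im (f w - h w) = 0" for w
  proof (intro exI ballI)
    fix z :: "complex ^ 'n" assume "z \<in> upper_half_space"
    \<comment> \<open>The constant \<open>f w - h w\<close> has imaginary part 0, so it equals its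
      real part, which serves as \<open>\<alpha>\<close>.\<close>
    from f_minus_h_constant[OF w this] w(2)
    show "f z = h z + complex_of_real (Re (f w - h w))"
      by (simp add: complex_eq_iff algebra_simps)
  qed
  thus ?thesis using linear_on_half_space by blast
qed

end
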